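(* Let $R$ be a commutative semiring. For every pair of objects $\mathfrak{A}=A_1\,\square\cdots\square\,A_n$ and $\mathfrak{B}=B_1\,\square\cdots\square\,B_m$ (finite lists of types), and for every $R$-linear map \[U:\ \bigoplus_{\mathfrak{E}\in\mathfrak{A}^{\bullet}}\mathcal{M}_{\mathfrak{E}}\ \longrightarrow\ \bigoplus_{\mathfrak{F}\in\mathfrak{B}^{\bullet}}\mathcal{M}_{\mathfrak{F}},\] there exist a finite world set $W$ and a labelled diagram $f$ over $W$ whose domain has underlying types $\mathfrak{A}$ and whose codomain has underlying types $\mathfrak{B}$ (with some labels) such that $[\![ [f]_W ]\!] = U$.
   Context: Fix a commutative semiring $(R,+,0,\times,1)$. Types are formal expressions $A,B::=\mathbb{1}\mid A\oplus B\mid A\otimes B$ (no identifications). An object is a finite list $A_1\,\square\cdots\square\,A_n$ of types (the empty list is allowed). Labelled diagrams. Fix a finite set $W$ of "worlds". A labelled color is a pair $(A:w)$ with $A$ a type and $w\subseteq W$. The labelled generators (each with a domain and a codomain, which are lists of labelled colors) are, for all types $A,B$ and subsets $w,v,w_1,\dots,w_n\subseteq W$: Identity $(A:w)\to(A:w)$; Swap $(A:w)\square(B:v)\to(B:v)\square(A:w)$; Cup $(A:w)\square(A:w)\to(\text{empty list})$; Cap $(\text{empty})\to(A:w)\square(A:w)$; Plus $(A:w)\square(B:v)\to(A\oplus B:w\sqcup v)$ with $w\cap v=\emptyset$; Tensor $(A:w)\square(B:w)\to(A\otimes B:w)$; Unit $(\text{empty})\to(\mathbb{1}:w)$; for every $n\ge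 0$ the $n$-ary Contraction $(A:w_1)\square\cdots\square(A:w_n)\to(A:w_1\sqcup\cdots\sqcup w_n)$ with the $w_i$ pairwise disjoint; Scalar $s$ for $s\in R$: $(A:w)\to(A:w)$; and the mirrored versions of Plus, Tensor, Unit, Contraction and Scalar, which have domain and codomain exchanged. A labelled diagram over $W$ is built from labelled generators by sequential composition $g\circ f$ (allowed when the codomain of $f$ equals the domain of $g$, labels included) and parallel composition $f\,\square\, g$ (concatenation of domains and of codomains). We write $[f]_W$ for $f$ viewed together with its world set $W$. Modules. For an object $\mathfrak{A}=A_1\square\cdots\square A_n$, its set of enablings $\mathfrak{A}^{\bullet}$ consists of the $2^n$ lists obtained by replacing any subset of the entries $A_i$ by the symbol $\bullet$. Define free $R$-modules (with their canonical bases): $\mathcal{M}_{\mathbb{1}}=\mathcal{M}_{\bullet}=R$, $\mathcal{M}_{A\oplus B}=\mathcal{M}_A\oplus\mathcal{M}_B$, $\mathcal{M}_{A\otimes B}=\mathcal{M}_A\otimes\mathcal{M}_B$, $\mathcal{M}_{E_1\square\cdots\square E_n}=\mathcal{M}_{E_1}\otimes\cdots\otimes\mathcal{M}_{E_n}$, and $\mathcal{M}$ of the empty list is $R$. For a list of labelled colors $\mathfrak{L}=(A_1:w_1)\square\cdots\square(A_n:w_n)$ and $a\in W$, let $\mathfrak{L}^{\bullet}_a\in(A_1\square\cdots\square A_n)^{\bullet}$ be obtained by keeping $A_i$ if $a\in w_i$ and replacing it by $\bullet$ otherwise. World semantics. For $a\in W$ and a labelled diagram $f$ with domain $\mathfrak{L}$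 and codomain $\mathfrak{L}'$, $[\![f]\!]_a:\mathcal{M}_{\mathfrak{L}^{\bullet}_a}\to\mathcal{M}_{\mathfrak{L}'^{\bullet}_a}$ is defined by $[\![g\circ f]\!]_a=[\![g]\!]_a\circ[\![f]\!]_a$, $[\![f\square g]\!]_a=[\![f]\!]_a\otimes[\![g]\!]_a$ and on generators: Swap is the identity of $\mathcal{M}_A$ if $a\in w\setminus v$, the identity of $\mathcal{M}_B$ if $a\in v\setminus w$, $h\otimes h'\mapsto h'\otimes h$ if $a\in w\cap v$; Cup is $h\otimes h'\mapsto\sum_i h_ih'_i$ (coordinates in the canonical basis) if $a\in w$, and Cap is its transpose $1\mapsto\sum_i e_i\otimes e_i$; Scalar $s$ is $s\cdot\mathrm{Id}$ on $\mathcal{M}_A$ if $a\in w$; Plus is the canonical injection $\mathcal{M}_A\to\mathcal{M}_A\oplus\mathcal{M}_B$ if $a\in w$ and $\mathcal{M}_B\to\mathcal{M}_A\oplus\mathcal{M}_B$ if $a\in v$, and mirrored Plus is the corresponding projection; Tensor (and mirrored Tensor) is the identity $\mathcal{M}_A\otimes\mathcal{M}_B=\mathcal{M}_{A\otimes B}$ if $a\in w$; Identity, Unit, Contraction and their mirrored versions are identity maps (for the Contraction in world $a$, at most one input is enabled, and the output is enabled exactly when one input is). In every case where none of the generator's wires is enabled in world $a$, the map is the identity $R\to R$. Worlds-agnostic semantics. For a labelled diagram $f$ over $W$ with domain $\mathfrak{L}$ (underlying types $\mathfrak{A}$) and codomain $\mathfrak{L}'$ (underlying types $\mathfrak{B}$),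 $[\![ [f]_W ]\!]:\bigoplus_{\mathfrak{E}\in\mathfrak{A}^{\bullet}}\mathcal{M}_{\mathfrak{E}}\to\bigoplus_{\mathfrak{F}\in\mathfrak{B}^{\bullet}}\mathcal{M}_{\mathfrak{F}}$ is the block map whose $(\mathfrak{E},\mathfrak{F})$ block is $\sum\{[\![f]\!]_a : a\in W,\ \mathfrak{L}^{\bullet}_a=\mathfrak{E},\ \mathfrak{L}'^{\bullet}_a=\mathfrak{F}\}$ (an empty sum being $0$). *)

theory Defs
  imports Main
begin

datatype ty = One | Oplus ty ty (infixr "\<oplus>" 65) | Otimes ty ty (infixr "\<otimes>" 70)

type_synonym 'w lcolor = "ty \<times> 'w set"

text \<open>In \<open>Seq g f\<close> the diagram \<open>f\<close> comes first. The constructor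
  \<open>Contraction A [w1, \<dots>, wn]\<close> is the \<open>n\<close>-ary contraction.\<close>

datatype ('w, 'r) diagram =
    Identity ty "'w set"
  | Swap ty "'w set" ty "'w set"
  | Cup ty "'w set"
  | Cap ty "'w set"
  | Plus ty "'w set" ty "'w set"
  | Plus_mirror ty "'w set" ty "'w set"
  | Tensor ty ty "'w set"
  | Tensor_mirror ty ty "'w set"
  | Unit "'w set"
  | Unit_mirror "'w set"
  | Contraction ty "'w set list"
  | Contraction_mirror ty "'w set list"
  | Scalar 'r ty "'w set"
  | Scalar_mirror 'r ty "'w set"
  | Seq "('w, 'r) diagram" "('w, 'r) diagram"
  | Par "('w, 'r) diagram" "('w, 'r) diagram"

primrec source :: "('w, 'r) diagram \<Rightarrow> 'w lcolor list"
  where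
    "source (Identity A w) = [(A, w)]"
  | "source (Swap A w B v) = [(A, w), (B, v)]"
  | "source (Cup A w) = [(A, w), (A, w)]"
  | "source (Cap A w) = []"
  | "source (Plus A w B v) = [(A, w), (B, v)]"
  | "source (Plus_mirror A w B v) = [(A \<oplus> B, w \<union> v)]"
  | "source (Tensor A B w) = [(A, w), (B, w)]"
  | "source (Tensor_mirror A B w) = [(A \<otimes> B, w)]"
  | "source (Unit w) = []"
  | "source (Unit_mirror w) = [(One, w)]"
  | "source (Contraction A ws) = map (Pair A) ws"
  | "source (Contraction_mirror A ws) = [(A, \<Union> (set ws))]"
  | "source (Scalar s A w) = [(A, w)]"
  | "source (Scalar_mirror s A w) = [(A, w)]"
  | "source (Seq g f) = source f"
  | "source (Par f g) = source f @ source g"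

primrec target :: "('w, 'r) diagram \<Rightarrow> 'w lcolor list"
  where
    "target (Identity A w) = [(A, w)]"
  | "target (Swap A w B v) = [(B, v), (A, w)]"
  | "target (Cup A w) = []"
  | "target (Cap A w) = [(A, w), (A, w)]"
  | "target (Plus A w B v) = [(A \<oplus> B, w \<union> v)]"
  | "target (Plus_mirror A w B v) = [(A, w), (B, v)]"
  | "target (Tensor A B w) = [(A \<otimes> B, w)]"
  | "target (Tensor_mirror A B w) = [(A, w), (B, w)]"
  | "target (Unit w) = [(One, w)]"
  | "target (Unit_mirror w) = []"
  | "target (Contraction A ws) = [(A, \<Union> (set ws))]"
  | "target (Contraction_mirror A ws) = map (Pair A) ws"
  | "target (Scalar s A w) = [(A, w)]"
  | "target (Scalar_mirror s A w) = [(A, w)]"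
  | "target (Seq g f) = target g"
  | "target (Par f g) = target f @ target g"

text \<open>\<open>sorted_wrt disjnt ws\<close> is disjointness of entries at different positions, so a nonempty
  label cannot be repeated, while the empty label can.\<close>

primrec labelled_diagram :: "'w set \<Rightarrow> ('w, 'r) diagram \<Rightarrow> bool" where
    "labelled_diagram W (Identity A w) \<longleftrightarrow> w \<subseteq> W"
  | "labelled_diagram W (Swap A w B v) \<longleftrightarrow> w \<subseteq> W \<and> v \<subseteq> W"
  | "labelled_diagram W (Cup A w) \<longleftrightarrow> w \<subseteq> W"
  | "labelled_diagram W (Cap A w) \<longleftrightarrow> w \<subseteq> W"
  | "labelled_diagram W (Plus A w B v) \<longleftrightarrow> w \<subseteq> W \<and> v \<subseteq> W \<and> w \<inter> v = {}"
  | "labelled_diagram W (Plus_mirror A w B v) \<longleftrightarrow> w \<subseteq> W \<and> v \<subseteq> W \<and> w \<inter> v = {}"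
  | "labelled_diagram W (Tensor A B w) \<longleftrightarrow> w \<subseteq> W"
  | "labelled_diagram W (Tensor_mirror A B w) \<longleftrightarrow> w \<subseteq> W"
  | "labelled_diagram W (Unit w) \<longleftrightarrow> w \<subseteq> W"
  | "labelled_diagram W (Unit_mirror w) \<longleftrightarrow> w \<subseteq> W"
  | "labelled_diagram W (Contraction A ws) \<longleftrightarrow> (\<forall>w\<in>set ws. w \<subseteq> W) \<and> sorted_wrt disjnt ws"
  | "labelled_diagram W (Contraction_mirror A ws) \<longleftrightarrow> (\<forall>w\<in>set ws. w \<subseteq> W) \<and> sorted_wrt disjnt ws"
  | "labelled_diagram W (Scalar s A w) \<longleftrightarrow> w \<subseteq> W"
  | "labelled_diagram W (Scalar_mirror s A w) \<longleftrightarrow> w \<subseteq> W"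
  | "labelled_diagram W (Seq g f) \<longleftrightarrow>
       labelled_diagram W g \<and> labelled_diagram W f \<and> target f = source g"
  | "labelled_diagram W (Par f g) \<longleftrightarrow> labelled_diagram W f \<and> labelled_diagram W g"

text \<open>The free module on a finite basis \<open>B\<close> consists of the coordinate functions vanishing
  outside \<open>B\<close>. The sort \<open>{comm_semiring_0, comm_monoid_mult}\<close> is that of all commutative
  semirings; the class \<open>comm_semiring_1\<close> would exclude the trivial one.\<close>

definition free_module :: "'b set \<Rightarrow> ('b \<Rightarrow> 'r::{comm_semiring_0, comm_monoid_mult}) set" where
  "free_module B = {u. \<forall>x. x \<notin> B \<longrightarrow> u x = 0}"

definition linear_map ::
  "'b set \<Rightarrow> 'c set \<Rightarrow> (('b \<Rightarrow> 'r::{comm_semiring_0, comm_monoid_mult}) \<Rightarrow> ('c \<Rightarrow> 'r)) \<Rightarrow> bool"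
  where
  "linear_map B C F \<longleftrightarrow>
     (\<forall>u\<in>free_module B. F u \<in> free_module C) \<and>
     (\<forall>u\<in>free_module B. \<forall>v\<in>free_module B. F (\<lambda>x. u x + v x) = (\<lambda>y. F u y + F v y)) \<and>
     (\<forall>r. \<forall>u\<in>free_module B. F (\<lambda>x. r * u x) = (\<lambda>y. r * F u y))"

datatype idx = Star | In1 idx | In2 idx | Pr idx idx

primrec basis :: "ty \<Rightarrow> idx set" where
  "basis One = {Star}"
| "basis (A \<oplus> B) = In1 ` basis A \<union> In2 ` basis B"
| "basis (A \<otimes> B) = (\<lambda>(x, y). Pr x y) ` (basis A \<times> basis B)"

text \<open>An entry \<open>None\<close> of an enabling is the symbol \<open>\<bullet>\<close>. A basis element of
  the module of an enabling lists the indices of the enabled entries only: the module $R$ of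
  \<open>\<bullet>\<close> has the basis \<open>{[]}\<close>, so that the canonical identifications of $R \otimes M$ and $M \otimes R$
  with $M$ are equalities, and the tensor product of basis elements is concatenation.\<close>

primrec entry_basis :: "ty option \<Rightarrow> idx list set" where
  "entry_basis None = {[]}"
| "entry_basis (Some A) = (\<lambda>x. [x]) ` basis A"

primrec enabling_basis :: "ty option list \<Rightarrow> idx list set" where
  "enabling_basis [] = {[]}"
| "enabling_basis (E # Es) = (\<lambda>(x, y). x @ y) ` (entry_basis E \<times> enabling_basis Es)"

definition enablings :: "ty list \<Rightarrow> ty option list set" where
  "enablings As = {Es. list_all2 (\<lambda>A E. E = Some A \<or> E = None) As Es}"

definition enable :: "'w \<Rightarrow> 'w lcolor list \<Rightarrow> ty option list" where
  "enable a L = map (\<lambda>(A, w). if a \<in> w then Some A else None) L"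

definition unit_vector :: "'b \<Rightarrow> 'b \<Rightarrow> 'r::{comm_semiring_0, comm_monoid_mult}" where
  "unit_vector x = (\<lambda>y. if y = x then 1 else 0)"

text \<open>All basis elements of one enabling have the same length, so for \<open>h\<close> and \<open>k\<close> in the modules of
  two enablings at most one summand is nonzero, and the coordinate of $h \otimes k$ at \<open>x @ y\<close> is
  \<open>h x * k y\<close>.\<close>

definition tensor_vec ::
  "(idx list \<Rightarrow> 'r) \<Rightarrow> (idx list \<Rightarrow> 'r) \<Rightarrow> idx list \<Rightarrow> 'r::{comm_semiring_0, comm_monoid_mult}"
  where
  "tensor_vec h k = (\<lambda>z. \<Sum>i\<le>length z. h (take i z) * k (drop i z))"

text \<open>The tensor product of linear maps whose domains have the bases \<open>B\<close> and \<open>C\<close>, determined by its values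
  $F(e_x) \otimes G(e_y)$ at $e_x \otimes e_y$.\<close>

definition tensor_map ::
  "idx list set \<Rightarrow> idx list set \<Rightarrow>
   ((idx list \<Rightarrow> 'r) \<Rightarrow> (idx list \<Rightarrow> 'r)) \<Rightarrow> ((idx list \<Rightarrow> 'r) \<Rightarrow> (idx list \<Rightarrow> 'r)) \<Rightarrow>
   (idx list \<Rightarrow> 'r) \<Rightarrow> (idx list \<Rightarrow> 'r::{comm_semiring_0, comm_monoid_mult})" where
  "tensor_map B C F G u =
     (\<lambda>z. \<Sum>x\<in>B. \<Sum>y\<in>C. u (x @ y) * tensor_vec (F (unit_vector x)) (G (unit_vector y)) z)"

text \<open>In the semantics of a labelled diagram in a world \<open>a\<close>, \<open>u\<close> is an argument of the map and \<open>z\<close>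
  the basis element at which the result is evaluated.\<close>

primrec world_semantics ::
  "'w \<Rightarrow> ('w, 'r) diagram \<Rightarrow>
   (idx list \<Rightarrow> 'r) \<Rightarrow> (idx list \<Rightarrow> 'r::{comm_semiring_0, comm_monoid_mult})" where
    "world_semantics a (Identity A w) = (\<lambda>u. u)"
  | "world_semantics a (Swap A w B v) =
       (if a \<in> w \<inter> v then \<lambda>u z. (case z of [y, x] \<Rightarrow> u [x, y] | _ \<Rightarrow> 0) else (\<lambda>u. u))"
  | "world_semantics a (Cup A w) =
       (if a \<in> w then \<lambda>u z. (case z of [] \<Rightarrow> \<Sum>i\<in>basis A. u [i, i] | _ \<Rightarrow> 0) else (\<lambda>u. u))"
  | "world_semantics a (Cap A w) =
       (if a \<in> w
        then \<lambda>u z. (case z of [i, j] \<Rightarrow> if i \<in> basis A \<and> i = j then u [] else 0 | _ \<Rightarrow> 0)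
        else (\<lambda>u. u))"
  | "world_semantics a (Plus A w B v) =
       (if a \<in> w then \<lambda>u z. (case z of [In1 x] \<Rightarrow> u [x] | _ \<Rightarrow> 0)
        else if a \<in> v then \<lambda>u z. (case z of [In2 y] \<Rightarrow> u [y] | _ \<Rightarrow> 0)
        else (\<lambda>u. u))"
  | "world_semantics a (Plus_mirror A w B v) =
       (if a \<in> w then \<lambda>u z. (case z of [x] \<Rightarrow> u [In1 x] | _ \<Rightarrow> 0)
        else if a \<in> v then \<lambda>u z. (case z of [y] \<Rightarrow> u [In2 y] | _ \<Rightarrow> 0)
        else (\<lambda>u. u))"
  | "world_semantics a (Tensor A B w) =
       (if a \<in> w then \<lambda>u z. (case z of [Pr x y] \<Rightarrow> u [x, y] | _ \<Rightarrow> 0) else (\<lambda>u. u))"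
  | "world_semantics a (Tensor_mirror A B w) =
       (if a \<in> w then \<lambda>u z. (case z of [x, y] \<Rightarrow> u [Pr x y] | _ \<Rightarrow> 0) else (\<lambda>u. u))"
  | "world_semantics a (Unit w) =
       (if a \<in> w then \<lambda>u z. (case z of [Star] \<Rightarrow> u [] | _ \<Rightarrow> 0) else (\<lambda>u. u))"
  | "world_semantics a (Unit_mirror w) =
       (if a \<in> w then \<lambda>u z. (case z of [] \<Rightarrow> u [Star] | _ \<Rightarrow> 0) else (\<lambda>u. u))"
  | "world_semantics a (Contraction A ws) = (\<lambda>u. u)"
  | "world_semantics a (Contraction_mirror A ws) = (\<lambda>u. u)"
  | "world_semantics a (Scalar s A w) = (if a \<in> w then \<lambda>u z. s * u z else (\<lambda>u. u))"
  | "world_semantics a (Scalar_mirror s A w) = (if a \<in> w then \<lambda>u z. s * u z else (\<lambda>u. u))"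
  | "world_semantics a (Seq g f) = world_semantics a g \<circ> world_semantics a f"
  | "world_semantics a (Par f g) =
       tensor_map (enabling_basis (enable a (source f))) (enabling_basis (enable a (source g)))
         (world_semantics a f) (world_semantics a g)"

text \<open>The basis of the direct sum of the modules of all enablings of \<open>As\<close>; the component at \<open>E\<close> of
  an element \<open>u\<close> of this sum is \<open>\<lambda>x. u (E, x)\<close>.\<close>

definition total_basis :: "ty list \<Rightarrow> (ty option list \<times> idx list) set" where
  "total_basis As = Sigma (enablings As) enabling_basis"

definition block ::
  "'w set \<Rightarrow> ('w, 'r) diagram \<Rightarrow> ty option list \<Rightarrow> ty option list \<Rightarrow>
   (idx list \<Rightarrow> 'r) \<Rightarrow> (idx list \<Rightarrow> 'r::{comm_semiring_0, comm_monoid_mult})" where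
  "block W f E F u =
     (\<lambda>y. \<Sum>a\<in>{a\<in>W. enable a (source f) = E \<and> enable a (target f) = F}. world_semantics a f u y)"

definition agnostic_semantics ::
  "'w set \<Rightarrow> ('w, 'r) diagram \<Rightarrow>
   (ty option list \<times> idx list \<Rightarrow> 'r) \<Rightarrow>
   (ty option list \<times> idx list \<Rightarrow> 'r::{comm_semiring_0, comm_monoid_mult})" where
  "agnostic_semantics W f u =
     (\<lambda>(F, y). \<Sum>E\<in>enablings (map fst (source f)). block W f E F (\<lambda>x. u (E, x)) y)"

end

theory Submission
  imports Defs
begin

text \<open>A linear map is the sum of its matrix entries, so take one world per pair of a basis
  element \<open>i\<close> of the domain and a basis element \<open>j\<close> of the codomain. In that world the diagram is
  the composite of the coordinate functional of \<open>i\<close> (a diagram into the empty list), the matrix entry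
  (an endomorphism of the empty list), and the basis vector \<open>j\<close> (a diagram out of the empty
  list). The functional is obtained by destructing types: the wire of a sum is split into the worlds
  whose index lies in the left and in the right summand, so neither contractions nor swaps are
  needed.\<close>

section \<open>Diagrams that act as a multiple of a matrix unit in a given world\<close>

text \<open>In world \<open>a\<close> the map is \<open>c\<close> times the matrix unit taking the
  basis vector at \<open>x\<close> to the one at \<open>y\<close>. The equation is restricted to
  vectors supported on the domain basis, because a generator without enabled wires acts as the
  identity on all functions and would carry stray coordinates along.\<close>

definition rank_one ::
  "'w \<Rightarrow> ('w, 'r::{comm_semiring_0, comm_monoid_mult}) diagram \<Rightarrow> 'r \<Rightarrow> idx list \<Rightarrow> idx list \<Rightarrow> bool"
  where
  "rank_one a f c x y \<longleftrightarrow>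
     x \<in> enabling_basis (enable a (source f)) \<and> y \<in> enabling_basis (enable a (target f)) \<and>
     (\<forall>u\<in>free_module (enabling_basis (enable a (source f))).
        world_semantics a f u = (\<lambda>z. if z = y then c * u x else 0))"

lemma rank_oneI:
  assumes "x \<in> enabling_basis (enable a (source f))" "y \<in> enabling_basis (enable a (target f))"
    and "\<And>u z. u \<in> free_module (enabling_basis (enable a (source f))) \<Longrightarrow>
           world_semantics a f u z = (if z = y then c * u x else 0)"
  shows "rank_one a f c x y"
  using assms unfolding rank_one_def by blast

lemma rank_oneD:
  assumes "rank_one a f c x y"
  shows "x \<in> enabling_basis (enable a (source f))" "y \<in> enabling_basis (enable a (target f))"
    and "u \<in> free_module (enabling_basis (enable a (source f))) \<Longrightarrow>
           world_semantics a f u = (\<lambda>z. if z = y then c * u x else 0)"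
  using assms unfolding rank_one_def by blast+

section \<open>Finiteness and membership for the bases\<close>

lemma finite_basis: "finite (basis A)"
  by (induction A) auto

lemma finite_enabling_basis: "finite (enabling_basis Es)"
proof (induction Es)
  case (Cons E Es)
  then show ?case by (cases E) (auto simp: finite_basis)
qed simp

lemma finite_enablings: "finite (enablings As)"
proof -
  have "enablings As \<subseteq> {Es. set Es \<subseteq> insert None (Some ` set As) \<and> length Es = length As}"
    by (fastforce simp: enablings_def list_all2_conv_all_nth in_set_conv_nth)
  moreover have "finite {Es. set Es \<subseteq> insert None (Some ` set As) \<and> length Es = length As}"
    by (rule finite_lists_length_eq) simp
  ultimately show ?thesis by (rule finite_subset)
qed

lemma finite_total_basis: "finite (total_basis As)"
  unfolding total_basis_def by (intro finite_SigmaI finite_enablings finite_enabling_basis)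

lemma append_in_enabling_basis:
  "x \<in> enabling_basis Es \<Longrightarrow> y \<in> enabling_basis Fs \<Longrightarrow> x @ y \<in> enabling_basis (Es @ Fs)"
proof (induction Es arbitrary: x)
  case (Cons E Es)
  from Cons.prems(1) obtain p q where "x = p @ q" "p \<in> entry_basis E" "q \<in> enabling_basis Es"
    by auto
  with Cons.IH[of q] Cons.prems(2) show ?case
    by (simp add: image_iff) blast
qed simp

text \<open>This rule and the next two take over from the recursive equation for
  \<open>enabling_basis\<close> in simplification: membership of a concrete list is decided entry by
  entry, without images of products.\<close>

lemma enabling_basis_None [simp]: "enabling_basis (None # Es) = enabling_basis Es"
  by (auto simp: image_iff)

lemma Cons_in_enabling_basis_Some [simp]:
  "x # xs \<in> enabling_basis (Some A # Es) \<longleftrightarrow> x \<in> basis A \<and> xs \<in> enabling_basis Es"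
  by (auto simp: image_iff)

lemma Nil_notin_enabling_basis_Some [simp]: "[] \<notin> enabling_basis (Some A # Es)"
  by auto

declare enabling_basis.simps(2) [simp del]

lemma enable_append: "enable a (L @ M) = enable a L @ enable a M"
  by (simp add: enable_def)

lemma unit_vector_in_free_module: "x \<in> B \<Longrightarrow> unit_vector x \<in> free_module B"
  by (auto simp: unit_vector_def free_module_def)

section \<open>Tensor products and composites of rank-one maps\<close>

text \<open>Among all ways of cutting \<open>z\<close> in two, only the cut after
  \<open>length x\<close> entries can give a nonzero term.\<close>

lemma tensor_vec_point:
  "tensor_vec (\<lambda>z. if z = x then p else 0) (\<lambda>z. if z = y then q else 0) =
     (\<lambda>z. if z = x @ y then p * q else 0)"
proof
  fix z
  have "tensor_vec (\<lambda>z. if z = x then p else 0) (\<lambda>z. if z = y then q else 0) z =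
      (\<Sum>i\<le>length z. if i = length x then if z = x @ y then p * q else 0 else 0)"
    unfolding tensor_vec_def
  proof (rule sum.cong)
    fix i assume "i \<in> {..length z}"
    \<comment> \<open>The bound \<open>i \<le> length z\<close> matters: it gives
      \<open>take i z\<close> the length \<open>i\<close>, so the cut point is determined by
      \<open>x\<close>.\<close>
    then have iff: "take i z = x \<and> drop i z = y \<longleftrightarrow> i = length x \<and> z = x @ y"
      by (metis append_eq_conv_conj append_take_drop_id atMost_iff length_take min.absorb2)
    have "(if take i z = x then p else 0) * (if drop i z = y then q else 0) =
        (if take i z = x \<and> drop i z = y then p * q else 0)"
      by simp
    also have "\<dots> = (if i = length x then if z = x @ y then p * q else 0 else 0)"
      unfolding iff by simp
    finally show "(if take i z = x then p else 0) * (if drop i z = y then q else 0) = \<dots>" .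
  qed simp
  also have "\<dots> = (if z = x @ y then p * q else 0)"
    by (auto simp: sum.delta)
  finally show "tensor_vec (\<lambda>z. if z = x then p else 0) (\<lambda>z. if z = y then q else 0) z =
      (if z = x @ y then p * q else 0)" .
qed

text \<open>A tensor product of maps is a sum over pairs of basis vectors \<open>p\<close>,
  \<open>q\<close>; the factors vanish on all of them except \<open>p = x\<close> and
  \<open>q = x'\<close>, so both sums collapse.\<close>

lemma rank_one_Par:
  assumes f: "rank_one a f c x y" and g: "rank_one a g d x' y'"
  shows "rank_one a (Par f g) (c * d) (x @ x') (y @ y')"
proof (rule rank_oneI)
  let ?B = "enabling_basis (enable a (source f))" and ?C = "enabling_basis (enable a (source g))"
  fix u :: "idx list \<Rightarrow> 'b" and z
  have "world_semantics a (Par f g) u z =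
      (\<Sum>p\<in>?B. \<Sum>q\<in>?C. u (p @ q) *
         (if z = y @ y' then (c * unit_vector p x) * (d * unit_vector q x') else 0))"
    by (simp add: tensor_map_def rank_oneD(3)[OF f] rank_oneD(3)[OF g]
        unit_vector_in_free_module tensor_vec_point)
  also have "\<dots> = (\<Sum>p\<in>?B. if p = x then
      \<Sum>q\<in>?C. if q = x' then if z = y @ y' then c * d * u (x @ x') else 0 else 0 else 0)"
    by (intro sum.cong refl) (auto simp: unit_vector_def mult_ac intro!: sum.cong sum.neutral)
  also have "\<dots> = (if z = y @ y' then c * d * u (x @ x') else 0)"
    using rank_oneD(1)[OF f] rank_oneD(1)[OF g] by (simp add: finite_enabling_basis)
  finally show "world_semantics a (Par f g) u z =
      (if z = y @ y' then c * d * u (x @ x') else 0)" .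
qed (use rank_oneD(1,2)[OF f] rank_oneD(1,2)[OF g] in
      \<open>simp_all add: enable_append append_in_enabling_basis\<close>)

text \<open>The map of \<open>g\<close> reads only the coordinate \<open>y\<close>, so
  \<open>f\<close> may be any map that stays in the module and puts the coordinate \<open>x\<close>
  of its argument at \<open>y\<close>. This is how a destructor is placed before a
  functional.\<close>

lemma rank_one_Seq_left:
  assumes g: "rank_one a g c y z"
    and eq: "target f = source g" and x: "x \<in> enabling_basis (enable a (source f))"
    and f: "\<And>u. u \<in> free_module (enabling_basis (enable a (source f))) \<Longrightarrow>
       world_semantics a f u \<in> free_module (enabling_basis (enable a (target f))) \<and>
       world_semantics a f u y = u x"
  shows "rank_one a (Seq g f) c x z"
  using rank_oneD(2)[OF g] f x by (intro rank_oneI) (auto simp: rank_oneD(3)[OF g] eq)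

text \<open>Every value of \<open>f\<close> is a multiple of the basis vector at \<open>y\<close>,
  so \<open>g\<close> matters on those multiples only. This is how a constructor is placed after a
  vector.\<close>

lemma rank_one_Seq_right:
  assumes f: "rank_one a f c x y"
    and z: "z \<in> enabling_basis (enable a (target g))"
    and g: "\<And>r. world_semantics a g (\<lambda>v. if v = y then r else 0) = (\<lambda>v. if v = z then r else 0)"
  shows "rank_one a (Seq g f) c x z"
  using rank_oneD(1)[OF f] z by (intro rank_oneI) (auto simp: rank_oneD(3)[OF f] g)

lemma rank_one_Seq:
  assumes f: "rank_one a f c x y" and g: "rank_one a g d y z" and eq: "target f = source g"
  shows "rank_one a (Seq g f) (d * c) x z"
proof (rule rank_oneI)
  fix u :: "idx list \<Rightarrow> 'b" and v
  assume u: "u \<in> free_module (enabling_basis (enable a (source (Seq g f))))"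
  have "(\<lambda>v. if v = y then c * u x else 0) \<in> free_module (enabling_basis (enable a (source g)))"
    using rank_oneD(1)[OF g] by (auto simp: free_module_def)
  with u show "world_semantics a (Seq g f) u v = (if v = z then d * c * u x else 0)"
    by (simp add: rank_oneD(3)[OF f] rank_oneD(3)[OF g] mult.assoc)
qed (use rank_oneD(1)[OF f] rank_oneD(2)[OF g] in auto)

section \<open>Coordinate functionals and basis vectors of a single wire\<close>

text \<open>One diagram serves all worlds, each with its own index \<open>\<phi> a\<close>. The
  induction on the type generalises \<open>w\<close> and \<open>\<phi>\<close>, since destructing a
  sum shrinks the label and destructing either connective passes to subindices. In worlds outside
  \<open>w\<close> the wire is disabled and the scalar 1 remains.\<close>

lemma ex_functional:
  assumes "w \<subseteq> W" "\<And>a. a \<in> w \<Longrightarrow> \<phi> a \<in> basis A"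
  shows "\<exists>f :: ('w, 'r::{comm_semiring_0, comm_monoid_mult}) diagram.
           labelled_diagram W f \<and> source f = [(A, w)] \<and> target f = [] \<and>
           (\<forall>a. rank_one a f 1 (if a \<in> w then [\<phi> a] else []) [])"
  using assms
proof (induction A arbitrary: w \<phi>)
  case One
  have "rank_one a (Unit_mirror w :: ('w, 'r) diagram) 1 (if a \<in> w then [\<phi> a] else []) []" for a
    using One(2)[of a]
    by (intro rank_oneI) (auto simp: enable_def free_module_def split: list.split)
  then show ?case
    using One by (intro exI[of _ "Unit_mirror w"]) simp
next
  case (Oplus A B)
  \<comment> \<open>A world goes to the side named by the outer constructor of its index. The two
    sides are disjoint, as \<open>Plus_mirror\<close> demands.\<close>
  define l where "l = {a \<in> w. \<phi> a \<in> In1 ` basis A}"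
  define r where "r = {a \<in> w. \<phi> a \<in> In2 ` basis B}"
  have w: "w = l \<union> r" and disj: "l \<inter> r = {}"
    using Oplus.prems(2) by (auto simp: l_def r_def)
  have lW: "l \<subseteq> W" and rW: "r \<subseteq> W" using Oplus.prems(1) w by auto
  have inv: "inv In1 (In1 x) = x" "inv In2 (In2 x) = x" for x
    by (simp_all add: inv_f_f inj_def)
  have l: "inv In1 (\<phi> a) \<in> basis A" if "a \<in> l" for a using that by (auto simp: l_def inv)
  have r: "inv In2 (\<phi> a) \<in> basis B" if "a \<in> r" for a using that by (auto simp: r_def inv)
  obtain f :: "('w, 'r) diagram" where f: "labelled_diagram W f" "source f = [(A, l)]" "target f = []"
    "\<And>a. rank_one a f 1 (if a \<in> l then [inv In1 (\<phi> a)] else []) []"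
    using Oplus.IH(1)[OF lW, of "\<lambda>a. inv In1 (\<phi> a)", OF l] by blast
  obtain g :: "('w, 'r) diagram" where g: "labelled_diagram W g" "source g = [(B, r)]" "target g = []"
    "\<And>a. rank_one a g 1 (if a \<in> r then [inv In2 (\<phi> a)] else []) []"
    using Oplus.IH(2)[OF rW, of "\<lambda>a. inv In2 (\<phi> a)", OF r] by blast
  have "rank_one a (Seq (Par f g) (Plus_mirror A l B r)) 1 (if a \<in> w then [\<phi> a] else []) []" for a
  proof -
    note fg = rank_one_Par[OF f(4)[of a] g(4)[of a]]
    \<comment> \<open>An enabled world enables exactly one of the two summands, so the functional of
      \<open>Par f g\<close> reads a single index there.\<close>
    consider (left) x where "a \<in> l" "a \<notin> r" "\<phi> a = In1 x" "x \<in> basis A"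
      | (right) x where "a \<notin> l" "a \<in> r" "\<phi> a = In2 x" "x \<in> basis B"
      | (off) "a \<notin> l" "a \<notin> r"
      using disj by (auto simp: l_def r_def)
    then show ?thesis
    proof cases
      case left
      with fg have "rank_one a (Par f g) 1 [x] []" by (simp add: inv)
      then show ?thesis
        by (rule rank_one_Seq_left)
          (use left in \<open>auto simp: f g w enable_def free_module_def image_iff
              split: list.split idx.split\<close>)
    next
      case right
      with fg have "rank_one a (Par f g) 1 [x] []" by (simp add: inv)
      then show ?thesis
        by (rule rank_one_Seq_left)
          (use right in \<open>auto simp: f g w enable_def free_module_def image_iff
              split: list.split idx.split\<close>)
    next
      case off
      with fg have "rank_one a (Par f g) 1 [] []" by simp
      then show ?thesis
        by (rule rank_one_Seq_left) (use off in \<open>auto simp: f g w enable_def\<close>)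
    qed
  qed
  then show ?case
    using f g disj lW rW w
    by (intro exI[of _ "Seq (Par f g) (Plus_mirror A l B r)"]) simp
next
  case (Otimes A B)
  \<comment> \<open>On \<open>w\<close> the index is always a pair, so the missing patterns of the
    case expressions are never reached.\<close>
  define l where "l a = (case \<phi> a of Pr x y \<Rightarrow> x)" for a
  define r where "r a = (case \<phi> a of Pr x y \<Rightarrow> y)" for a
  have l: "l a \<in> basis A" and r: "r a \<in> basis B" if "a \<in> w" for a
    using Otimes.prems(2)[OF that] by (auto simp: l_def r_def)
  obtain f :: "('w, 'r) diagram" where f: "labelled_diagram W f" "source f = [(A, w)]" "target f = []"
    "\<And>a. rank_one a f 1 (if a \<in> w then [l a] else []) []"
    using Otimes.IH(1)[OF Otimes.prems(1), of l, OF l] by blast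
  obtain g :: "('w, 'r) diagram" where g: "labelled_diagram W g" "source g = [(B, w)]" "target g = []"
    "\<And>a. rank_one a g 1 (if a \<in> w then [r a] else []) []"
    using Otimes.IH(2)[OF Otimes.prems(1), of r, OF r] by blast
  have "rank_one a (Seq (Par f g) (Tensor_mirror A B w)) 1 (if a \<in> w then [\<phi> a] else []) []" for a
  proof (cases "a \<in> w")
    case True
    then obtain x y where xy: "\<phi> a = Pr x y" "x \<in> basis A" "y \<in> basis B"
      using Otimes.prems(2) by force
    with True have "rank_one a (Par f g) 1 [x, y] []"
      using rank_one_Par[OF f(4)[of a] g(4)[of a]] by (simp add: l_def r_def)
    then show ?thesis
      by (rule rank_one_Seq_left)
        (use True xy in \<open>auto simp: f g enable_def free_module_def image_iff
              split: list.split idx.split\<close>)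
  next
    case False
    then have "rank_one a (Par f g) 1 [] []"
      using rank_one_Par[OF f(4)[of a] g(4)[of a]] by simp
    then show ?thesis
      by (rule rank_one_Seq_left) (use False in \<open>auto simp: f g enable_def\<close>)
  qed
  then show ?case
    using f g Otimes.prems(1)
    by (intro exI[of _ "Seq (Par f g) (Tensor_mirror A B w)"]) simp
qed

text \<open>The transpose of \<open>ex_functional\<close>: the constructors \<open>Plus\<close>,
  \<open>Tensor\<close> and \<open>Unit\<close> replace the destructors and come last, so the
  composition rule is now \<open>rank_one_Seq_right\<close>.\<close>

lemma ex_vector:
  assumes "w \<subseteq> W" "\<And>a. a \<in> w \<Longrightarrow> \<phi> a \<in> basis A"
  shows "\<exists>f :: ('w, 'r::{comm_semiring_0, comm_monoid_mult}) diagram.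
           labelled_diagram W f \<and> source f = [] \<and> target f = [(A, w)] \<and>
           (\<forall>a. rank_one a f 1 [] (if a \<in> w then [\<phi> a] else []))"
  using assms
proof (induction A arbitrary: w \<phi>)
  case One
  have "rank_one a (Unit w :: ('w, 'r) diagram) 1 [] (if a \<in> w then [\<phi> a] else [])" for a
    using One(2)[of a]
    by (intro rank_oneI) (auto simp: enable_def free_module_def split: list.split idx.split)
  then show ?case
    using One by (intro exI[of _ "Unit w"]) simp
next
  case (Oplus A B)
  define l where "l = {a \<in> w. \<phi> a \<in> In1 ` basis A}"
  define r where "r = {a \<in> w. \<phi> a \<in> In2 ` basis B}"
  have w: "w = l \<union> r" and disj: "l \<inter> r = {}"
    using Oplus.prems(2) by (auto simp: l_def r_def)
  have lW: "l \<subseteq> W" and rW: "r \<subseteq> W" using Oplus.prems(1) w by auto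
  have inv: "inv In1 (In1 x) = x" "inv In2 (In2 x) = x" for x
    by (simp_all add: inv_f_f inj_def)
  have l: "inv In1 (\<phi> a) \<in> basis A" if "a \<in> l" for a using that by (auto simp: l_def inv)
  have r: "inv In2 (\<phi> a) \<in> basis B" if "a \<in> r" for a using that by (auto simp: r_def inv)
  obtain f :: "('w, 'r) diagram" where f: "labelled_diagram W f" "source f = []" "target f = [(A, l)]"
    "\<And>a. rank_one a f 1 [] (if a \<in> l then [inv In1 (\<phi> a)] else [])"
    using Oplus.IH(1)[OF lW, of "\<lambda>a. inv In1 (\<phi> a)", OF l] by blast
  obtain g :: "('w, 'r) diagram" where g: "labelled_diagram W g" "source g = []" "target g = [(B, r)]"
    "\<And>a. rank_one a g 1 [] (if a \<in> r then [inv In2 (\<phi> a)] else [])"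
    using Oplus.IH(2)[OF rW, of "\<lambda>a. inv In2 (\<phi> a)", OF r] by blast
  have "rank_one a (Seq (Plus A l B r) (Par f g)) 1 [] (if a \<in> w then [\<phi> a] else [])" for a
  proof -
    note fg = rank_one_Par[OF f(4)[of a] g(4)[of a]]
    consider (left) x where "a \<in> l" "a \<notin> r" "\<phi> a = In1 x" "x \<in> basis A"
      | (right) x where "a \<notin> l" "a \<in> r" "\<phi> a = In2 x" "x \<in> basis B"
      | (off) "a \<notin> l" "a \<notin> r"
      using disj by (auto simp: l_def r_def)
    then show ?thesis
    proof cases
      case left
      with fg have "rank_one a (Par f g) 1 [] [x]" by (simp add: inv)
      then show ?thesis
        by (rule rank_one_Seq_right)
          (use left in \<open>auto simp: f g w enable_def fun_eq_iff split: list.split idx.split\<close>)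
    next
      case right
      with fg have "rank_one a (Par f g) 1 [] [x]" by (simp add: inv)
      then show ?thesis
        by (rule rank_one_Seq_right)
          (use right in \<open>auto simp: f g w enable_def fun_eq_iff split: list.split idx.split\<close>)
    next
      case off
      with fg have "rank_one a (Par f g) 1 [] []" by simp
      then show ?thesis
        by (rule rank_one_Seq_right) (use off in \<open>auto simp: f g w enable_def\<close>)
    qed
  qed
  then show ?case
    using f g disj lW rW w
    by (intro exI[of _ "Seq (Plus A l B r) (Par f g)"]) simp
next
  case (Otimes A B)
  define l where "l a = (case \<phi> a of Pr x y \<Rightarrow> x)" for a
  define r where "r a = (case \<phi> a of Pr x y \<Rightarrow> y)" for a
  have l: "l a \<in> basis A" and r: "r a \<in> basis B" if "a \<in> w" for a
    using Otimes.prems(2)[OF that] by (auto simp: l_def r_def)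
  obtain f :: "('w, 'r) diagram" where f: "labelled_diagram W f" "source f = []" "target f = [(A, w)]"
    "\<And>a. rank_one a f 1 [] (if a \<in> w then [l a] else [])"
    using Otimes.IH(1)[OF Otimes.prems(1), of l, OF l] by blast
  obtain g :: "('w, 'r) diagram" where g: "labelled_diagram W g" "source g = []" "target g = [(B, w)]"
    "\<And>a. rank_one a g 1 [] (if a \<in> w then [r a] else [])"
    using Otimes.IH(2)[OF Otimes.prems(1), of r, OF r] by blast
  have "rank_one a (Seq (Tensor A B w) (Par f g)) 1 [] (if a \<in> w then [\<phi> a] else [])" for a
  proof (cases "a \<in> w")
    case True
    then obtain x y where xy: "\<phi> a = Pr x y" "x \<in> basis A" "y \<in> basis B"
      using Otimes.prems(2) by force
    with True have "rank_one a (Par f g) 1 [] [x, y]"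
      using rank_one_Par[OF f(4)[of a] g(4)[of a]] by (simp add: l_def r_def)
    then show ?thesis
      by (rule rank_one_Seq_right)
        (use True xy in \<open>auto simp: f g enable_def fun_eq_iff split: list.split idx.split\<close>)
  next
    case False
    then have "rank_one a (Par f g) 1 [] []"
      using rank_one_Par[OF f(4)[of a] g(4)[of a]] by simp
    then show ?thesis
      by (rule rank_one_Seq_right) (use False in \<open>auto simp: f g enable_def\<close>)
  qed
  then show ?case
    using f g Otimes.prems(1)
    by (intro exI[of _ "Seq (Tensor A B w) (Par f g)"]) simp
qed

section \<open>Endomorphisms of the empty list\<close>

text \<open>There is no generator for the empty diagram; a unit with the empty label, capped off, replaces
  it.\<close>

lemma ex_empty_diagram:
  "\<exists>f :: ('w, 'r::{comm_semiring_0, comm_monoid_mult}) diagram.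
     labelled_diagram W f \<and> source f = [] \<and> target f = [] \<and> (\<forall>a. rank_one a f 1 [] [])"
  by (intro exI[of _ "Seq (Unit_mirror {}) (Unit {})"])
    (auto intro!: rank_oneI simp: enable_def free_module_def)

text \<open>The worlds of \<open>V\<close> are treated one at a time. The default coefficient 1 is
  neutral for composition, so each new factor changes one world and leaves the others alone.\<close>

lemma ex_scalar_diagram:
  assumes "finite V" "V \<subseteq> W"
  shows "\<exists>f :: ('w, 'r::{comm_semiring_0, comm_monoid_mult}) diagram.
           labelled_diagram W f \<and> source f = [] \<and> target f = [] \<and>
           (\<forall>a. rank_one a f (if a \<in> V then c a else 1) [] [])"
  using assms
proof (induction V rule: finite_induct)
  case empty
  then show ?case using ex_empty_diagram by simp
next
  case (insert b V)
  obtain f :: "('w, 'r) diagram" where f: "labelled_diagram W f" "source f = []" "target f = []"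
    "\<And>a. rank_one a f (if a \<in> V then c a else 1) [] []"
    using insert by auto
  \<comment> \<open>Labelled by the single world \<open>b\<close>, this closed wire multiplies by
    \<open>c b\<close> in that world and is the identity of the scalars in every other.\<close>
  define g where "g = Seq (Unit_mirror {b}) (Seq (Scalar (c b) One {b}) (Unit {b}))"
  have g: "rank_one a g (if a = b then c b else 1) [] []" for a
    by (auto intro!: rank_oneI simp: g_def enable_def free_module_def split: list.split)
  have "rank_one a (Seq g f) (if a \<in> insert b V then c a else 1) [] []" for a
    using rank_one_Seq[OF f(4)[of a] g[of a]] insert.hyps
    by (cases "a = b") (auto simp: f g_def)
  then show ?case
    using f insert.prems by (intro exI[of _ "Seq g f"]) (auto simp: g_def)
qed

section \<open>From single wires to lists of types\<close>

lemma total_basis_Nil: "total_basis [] = {([], [])}"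
  by (auto simp: total_basis_def enablings_def)

text \<open>Indices are recorded for enabled entries only, so removing the first wire consumes an
  index exactly when that wire is enabled.\<close>

lemma total_basis_Cons:
  assumes "(Es, x) \<in> total_basis (A # As)"
  obtains (off) Fs where "Es = None # Fs" "(Fs, x) \<in> total_basis As"
  | (on) Fs i y where "Es = Some A # Fs" "x = i # y" "i \<in> basis A" "(Fs, y) \<in> total_basis As"
proof -
  from assms obtain E Fs where Es: "Es = E # Fs" "E = Some A \<or> E = None" "Fs \<in> enablings As"
    and x: "x \<in> enabling_basis Es"
    by (auto simp: total_basis_def enablings_def list_all2_Cons1)
  from x Es(1) obtain p y where y: "x = p @ y" "p \<in> entry_basis E" "y \<in> enabling_basis Fs"
    by (auto simp: enabling_basis.simps(2))
  have F: "(Fs, y) \<in> total_basis As" using Es(3) y(3) by (simp add: total_basis_def)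
  from Es(2) show thesis
  proof
    assume "E = None"
    then show thesis using off[of Fs] Es(1) y F by simp
  next
    assume "E = Some A"
    then show thesis using on[of Fs _ y] Es(1) y F by auto
  qed
qed

text \<open>Converts a choice of basis element per world into the input of the single-wire lemmas, a
  label and an index function for the first wire, and leaves such a choice for the other
  wires.\<close>

lemma total_basis_decompose:
  assumes "\<And>a. a \<in> W \<Longrightarrow> h a \<in> total_basis (A # As)"
  shows "\<exists>w \<phi> h'. w \<subseteq> W \<and> (\<forall>a\<in>w. \<phi> a \<in> basis A) \<and> (\<forall>a\<in>W. h' a \<in> total_basis As) \<and>
    (\<forall>a\<in>W. h a =
       (enable a [(A, w)] @ fst (h' a), (if a \<in> w then [\<phi> a] else []) @ snd (h' a)))"
proof -
  \<comment> \<open>The labels of the final diagram originate here: a wire is enabled in the worlds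
    whose prescribed enabling keeps its type.\<close>
  define w where "w = {a \<in> W. hd (fst (h a)) = Some A}"
  \<comment> \<open>Outside \<open>w\<close> this value is meaningless, and only its values on
    \<open>w\<close> enter.\<close>
  define \<phi> where "\<phi> a = hd (snd (h a))" for a
  define h' where "h' a = (tl (fst (h a)), if a \<in> w then tl (snd (h a)) else snd (h a))" for a
  have "(a \<in> w \<longrightarrow> \<phi> a \<in> basis A) \<and> h' a \<in> total_basis As \<and>
      h a = (enable a [(A, w)] @ fst (h' a), (if a \<in> w then [\<phi> a] else []) @ snd (h' a))"
    if "a \<in> W" for a
  proof -
    obtain Es x where h: "h a = (Es, x)" by force
    with assms[OF that] have "(Es, x) \<in> total_basis (A # As)" by simp
    then show ?thesis
      by (cases rule: total_basis_Cons) (use h that in \<open>auto simp: w_def \<phi>_def h'_def enable_def\<close>)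
  qed
  moreover have "w \<subseteq> W" by (auto simp: w_def)
  ultimately show ?thesis
    by (intro exI[of _ w] exI[of _ \<phi>] exI[of _ h']) blast
qed

text \<open>The functionals of the separate wires are put in parallel. Their labels make each world
  of \<open>W\<close> enable exactly the entries that \<open>h a\<close> prescribes.\<close>

lemma ex_total_functional:
  assumes "\<And>a. a \<in> W \<Longrightarrow> h a \<in> total_basis As"
  shows "\<exists>f :: ('w, 'r::{comm_semiring_0, comm_monoid_mult}) diagram.
           labelled_diagram W f \<and> map fst (source f) = As \<and> target f = [] \<and>
           (\<forall>a\<in>W. enable a (source f) = fst (h a) \<and> rank_one a f 1 (snd (h a)) [])"
  using assms
proof (induction As arbitrary: h)
  case Nil
  obtain f :: "('w, 'r) diagram" where "labelled_diagram W f" "source f = []" "target f = []"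
    "\<And>a. rank_one a f 1 [] []"
    using ex_empty_diagram by blast
  with Nil show ?case
    by (intro exI[of _ f]) (simp add: total_basis_Nil enable_def)
next
  case (Cons A As)
  have "\<exists>w \<phi> h'. w \<subseteq> W \<and> (\<forall>a\<in>w. \<phi> a \<in> basis A) \<and> (\<forall>a\<in>W. h' a \<in> total_basis As) \<and>
    (\<forall>a\<in>W. h a =
       (enable a [(A, w)] @ fst (h' a), (if a \<in> w then [\<phi> a] else []) @ snd (h' a)))"
    by (rule total_basis_decompose) (rule Cons.prems)
  then obtain w \<phi> h' where wh: "w \<subseteq> W" "\<forall>a\<in>w. \<phi> a \<in> basis A" "\<forall>a\<in>W. h' a \<in> total_basis As"
    "\<forall>a\<in>W. h a =
       (enable a [(A, w)] @ fst (h' a), (if a \<in> w then [\<phi> a] else []) @ snd (h' a))"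
    by (elim exE conjE)
  obtain f :: "('w, 'r) diagram" where f: "labelled_diagram W f" "source f = [(A, w)]" "target f = []"
    "\<And>a. rank_one a f 1 (if a \<in> w then [\<phi> a] else []) []"
    using ex_functional[OF wh(1), of \<phi> A] wh(2) by blast
  obtain g :: "('w, 'r) diagram" where g: "labelled_diagram W g" "map fst (source g) = As"
    "target g = []" "\<And>a. a \<in> W \<Longrightarrow> enable a (source g) = fst (h' a)"
    "\<And>a. a \<in> W \<Longrightarrow> rank_one a g 1 (snd (h' a)) []"
    using Cons.IH[of h'] wh(3) by blast
  have "enable a (source (Par f g)) = fst (h a) \<and> rank_one a (Par f g) 1 (snd (h a)) []"
    if "a \<in> W" for a
    using rank_one_Par[OF f(4)[of a] g(5)[OF that]] enable_append[of a "[(A, w)]" "source g"]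
    by (simp add: bspec[OF wh(4) that] g(4)[OF that] f(2))
  then show ?case
    using f g by (intro exI[of _ "Par f g"]) simp
qed

text \<open>The codomain counterpart of \<open>ex_total_functional\<close>, built from
  \<open>ex_vector\<close>.\<close>

lemma ex_total_vector:
  assumes "\<And>a. a \<in> W \<Longrightarrow> h a \<in> total_basis As"
  shows "\<exists>f :: ('w, 'r::{comm_semiring_0, comm_monoid_mult}) diagram.
           labelled_diagram W f \<and> source f = [] \<and> map fst (target f) = As \<and>
           (\<forall>a\<in>W. enable a (target f) = fst (h a) \<and> rank_one a f 1 [] (snd (h a)))"
  using assms
proof (induction As arbitrary: h)
  case Nil
  obtain f :: "('w, 'r) diagram" where "labelled_diagram W f" "source f = []" "target f = []"
    "\<And>a. rank_one a f 1 [] []"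
    using ex_empty_diagram by blast
  with Nil show ?case
    by (intro exI[of _ f]) (simp add: total_basis_Nil enable_def)
next
  case (Cons A As)
  have "\<exists>w \<phi> h'. w \<subseteq> W \<and> (\<forall>a\<in>w. \<phi> a \<in> basis A) \<and> (\<forall>a\<in>W. h' a \<in> total_basis As) \<and>
    (\<forall>a\<in>W. h a =
       (enable a [(A, w)] @ fst (h' a), (if a \<in> w then [\<phi> a] else []) @ snd (h' a)))"
    by (rule total_basis_decompose) (rule Cons.prems)
  then obtain w \<phi> h' where wh: "w \<subseteq> W" "\<forall>a\<in>w. \<phi> a \<in> basis A" "\<forall>a\<in>W. h' a \<in> total_basis As"
    "\<forall>a\<in>W. h a =
       (enable a [(A, w)] @ fst (h' a), (if a \<in> w then [\<phi> a] else []) @ snd (h' a))"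
    by (elim exE conjE)
  obtain f :: "('w, 'r) diagram" where f: "labelled_diagram W f" "source f = []" "target f = [(A, w)]"
    "\<And>a. rank_one a f 1 [] (if a \<in> w then [\<phi> a] else [])"
    using ex_vector[OF wh(1), of \<phi> A] wh(2) by blast
  obtain g :: "('w, 'r) diagram" where g: "labelled_diagram W g" "source g = []"
    "map fst (target g) = As" "\<And>a. a \<in> W \<Longrightarrow> enable a (target g) = fst (h' a)"
    "\<And>a. a \<in> W \<Longrightarrow> rank_one a g 1 [] (snd (h' a))"
    using Cons.IH[of h'] wh(3) by blast
  have "enable a (target (Par f g)) = fst (h a) \<and> rank_one a (Par f g) 1 [] (snd (h a))"
    if "a \<in> W" for a
    using rank_one_Par[OF f(4)[of a] g(5)[OF that]] enable_append[of a "[(A, w)]" "target g"]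
    by (simp add: bspec[OF wh(4) that] g(4)[OF that] f(3))
  then show ?case
    using f g by (intro exI[of _ "Par f g"]) simp
qed

section \<open>Assembling matrix units and summing over the worlds\<close>

text \<open>Since the composite passes through the empty list, the labels of the domain and of the
  codomain can be chosen independently: no label has to match in the middle.\<close>

lemma ex_matrix_unit_diagram:
  assumes "finite W" "\<And>a. a \<in> W \<Longrightarrow> h a \<in> total_basis As" "\<And>a. a \<in> W \<Longrightarrow> k a \<in> total_basis Bs"
  shows "\<exists>f :: ('w, 'r::{comm_semiring_0, comm_monoid_mult}) diagram.
           labelled_diagram W f \<and> map fst (source f) = As \<and> map fst (target f) = Bs \<and>
           (\<forall>a\<in>W. enable a (source f) = fst (h a) \<and> enable a (target f) = fst (k a) \<and>
                   rank_one a f (c a) (snd (h a)) (snd (k a)))"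
proof -
  obtain f :: "('w, 'r) diagram" where f: "labelled_diagram W f" "map fst (source f) = As"
    "target f = []" "\<And>a. a \<in> W \<Longrightarrow> enable a (source f) = fst (h a)"
    "\<And>a. a \<in> W \<Longrightarrow> rank_one a f 1 (snd (h a)) []"
    using ex_total_functional[of W h As] assms(2) by blast
  obtain s :: "('w, 'r) diagram" where s: "labelled_diagram W s" "source s = []" "target s = []"
    "\<And>a. rank_one a s (if a \<in> W then c a else 1) [] []"
    using ex_scalar_diagram[OF assms(1) subset_refl] by blast
  obtain g :: "('w, 'r) diagram" where g: "labelled_diagram W g" "source g = []"
    "map fst (target g) = Bs" "\<And>a. a \<in> W \<Longrightarrow> enable a (target g) = fst (k a)"
    "\<And>a. a \<in> W \<Longrightarrow> rank_one a g 1 [] (snd (k a))"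
    using ex_total_vector[of W k Bs] assms(3) by blast
  have "rank_one a (Seq g (Seq s f)) (c a) (snd (h a)) (snd (k a))" if "a \<in> W" for a
    using rank_one_Seq[OF rank_one_Seq[OF f(5)[OF that] s(4)[of a]] g(5)[OF that]] that
    by (simp add: f s g)
  then show ?thesis
    using f s g by (intro exI[of _ "Seq g (Seq s f)"]) simp
qed

text \<open>Each world contributes to one block only, at the enablings \<open>fst (h a)\<close> and
  \<open>fst (k a)\<close>. The sum over domain enablings of block sums therefore becomes a single
  sum over worlds.\<close>

lemma agnostic_semantics_rank_one:
  assumes "finite W" and src: "map fst (source f) = As"
    and h: "\<And>a. a \<in> W \<Longrightarrow> h a \<in> total_basis As"
    and f: "\<And>a. a \<in> W \<Longrightarrow> enable a (source f) = fst (h a)"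
      "\<And>a. a \<in> W \<Longrightarrow> enable a (target f) = fst (k a)"
      "\<And>a. a \<in> W \<Longrightarrow> rank_one a f (c a) (snd (h a)) (snd (k a))"
    and u: "u \<in> free_module (total_basis As)"
  shows "agnostic_semantics W f u = (\<lambda>j. \<Sum>a\<in>W. if j = k a then c a * u (h a) else 0)"
proof (rule ext, clarify)
  fix F y
  have "agnostic_semantics W f u (F, y) =
      (\<Sum>E\<in>enablings As. \<Sum>a\<in>W. if E = fst (h a) then
         if (F, y) = k a then c a * u (h a) else 0 else 0)"
    unfolding agnostic_semantics_def block_def src prod.case
  proof (rule sum.cong[OF refl])
    fix E
    have sem: "world_semantics a f (\<lambda>x. u (fst (h a), x)) y =
        (if y = snd (k a) then c a * u (h a) else 0)" if "a \<in> W" for a y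
    proof -
      \<comment> \<open>The component of \<open>u\<close> at the enabling is supported on its basis,
        which the equation in \<open>rank_one\<close> requires.\<close>
      have "(\<lambda>x. u (fst (h a), x)) \<in> free_module (enabling_basis (fst (h a)))"
        using u h[OF that] by (auto simp: free_module_def total_basis_def)
      then show ?thesis
        using rank_oneD(3)[OF f(3)[OF that]] f(1)[OF that] by simp
    qed
    have "(\<Sum>a\<in>{a\<in>W. enable a (source f) = E \<and> enable a (target f) = F}.
        world_semantics a f (\<lambda>x. u (E, x)) y) =
        (\<Sum>a\<in>W. if enable a (source f) = E \<and> enable a (target f) = F
           then world_semantics a f (\<lambda>x. u (E, x)) y else 0)"
      by (rule sum.inter_filter[OF assms(1)])
    also have "\<dots> = (\<Sum>a\<in>W. if E = fst (h a) then
         if (F, y) = k a then c a * u (h a) else 0 else 0)"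
      by (intro sum.cong refl) (auto simp: f(1,2) sem prod_eq_iff)
    finally show "(\<Sum>a\<in>{a\<in>W. enable a (source f) = E \<and> enable a (target f) = F}.
        world_semantics a f (\<lambda>x. u (E, x)) y) = \<dots>" .
  qed
  \<comment> \<open>With the sums exchanged, the sum over enablings for a fixed world has its only
    possibly nonzero term at \<open>fst (h a)\<close>.\<close>
  also have "\<dots> = (\<Sum>a\<in>W. \<Sum>E\<in>enablings As. if E = fst (h a) then
         if (F, y) = k a then c a * u (h a) else 0 else 0)"
    by (rule sum.swap)
  also have "\<dots> = (\<Sum>a\<in>W. if (F, y) = k a then c a * u (h a) else 0)"
  proof (rule sum.cong[OF refl])
    fix a assume "a \<in> W"
    then have "fst (h a) \<in> enablings As" using h[of a] by (auto simp: total_basis_def)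
    then show "(\<Sum>E\<in>enablings As. if E = fst (h a) then
        if (F, y) = k a then c a * u (h a) else 0 else 0) =
        (if (F, y) = k a then c a * u (h a) else 0)"
      by (simp add: finite_enablings)
  qed
  finally show "agnostic_semantics W f u (F, y) =
      (\<Sum>a\<in>W. if (F, y) = k a then c a * u (h a) else 0)" .
qed

text \<open>Additivity is given for two summands at a time, so the expansion is proved for the
  restriction of \<open>u\<close> to a finite \<open>S \<subseteq> B\<close>, by adding one basis
  element to \<open>S\<close> at each step.\<close>

lemma linear_map_expand:
  assumes U: "linear_map B C U" and "finite B" and u: "u \<in> free_module B"
  shows "U u = (\<lambda>j. \<Sum>i\<in>B. U (unit_vector i) j * u i)"
proof -
  have add: "U (\<lambda>x. u x + v x) = (\<lambda>y. U u y + U v y)"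
    if "u \<in> free_module B" "v \<in> free_module B" for u v
    using U that unfolding linear_map_def by blast
  have restrict: "(\<lambda>x. if x \<in> B then u x else 0) = u"
    using u by (auto simp: free_module_def)
  have "U (\<lambda>x. if x \<in> S then u x else 0) = (\<lambda>j. \<Sum>i\<in>S. U (unit_vector i) j * u i)"
    if "finite S" "S \<subseteq> B" for S
    using that
  proof (induction S rule: finite_induct)
    case empty
    \<comment> \<open>A semiring has no subtraction, so \<open>U\<close> preserves zero by
      homogeneity with scalar 0 rather than by cancellation.\<close>
    have "U (\<lambda>x. 0 * u x) = (\<lambda>y. 0 * U u y)"
      using U u unfolding linear_map_def by blast
    then show ?case by simp
  next
    case (insert b S)
    let ?v = "\<lambda>x. if x \<in> S then u x else 0"
    have e: "unit_vector b \<in> free_module B" "(\<lambda>x. u b * unit_vector b x) \<in> free_module B"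
      "?v \<in> free_module B"
      using insert.prems by (auto simp: free_module_def unit_vector_def)
    have "U (\<lambda>x. if x \<in> insert b S then u x else 0) = U (\<lambda>x. u b * unit_vector b x + ?v x)"
      using insert.hyps by (intro arg_cong[of _ _ U]) (auto simp: unit_vector_def)
    also have "\<dots> = (\<lambda>j. U (\<lambda>x. u b * unit_vector b x) j + U ?v j)"
      by (rule add[OF e(2,3)])
    also have "U (\<lambda>x. u b * unit_vector b x) = (\<lambda>j. u b * U (unit_vector b) j)"
      using U e(1) unfolding linear_map_def by blast
    finally show ?case
      using insert by (simp add: mult.commute)
  qed
  from this[OF \<open>finite B\<close> subset_refl] show ?thesis
    unfolding restrict .
qed

section \<open>Universality\<close>

theorem mainTheorem1:
  fixes As Bs :: "ty list"
    and U :: "(ty option list \<times> idx list \<Rightarrow> 'r::{comm_semiring_0, comm_monoid_mult}) \<Rightarrow>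
              (ty option list \<times> idx list \<Rightarrow> 'r)"
  assumes "linear_map (total_basis As) (total_basis Bs) U"
  shows "\<exists>(W :: nat set) (f :: (nat, 'r) diagram).
           finite W \<and> labelled_diagram W f \<and>
           map fst (source f) = As \<and> map fst (target f) = Bs \<and>
           (\<forall>u\<in>free_module (total_basis As). agnostic_semantics W f u = U u)"
proof -
  let ?I = "total_basis As" and ?J = "total_basis Bs"
  have "finite (?I \<times> ?J)" by (simp add: finite_total_basis)
  \<comment> \<open>Worlds are natural numbers, so the pairs of basis elements are numbered by a
    bijection \<open>p\<close>.\<close>
  then obtain p where p: "bij_betw p {0..<card (?I \<times> ?J)} (?I \<times> ?J)"
    using ex_bij_betw_nat_finite by blast
  define W where "W = {0..<card (?I \<times> ?J)}"
  define h where "h a = fst (p a)" for a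
  define k where "k a = snd (p a)" for a
  have hk: "h a \<in> ?I" "k a \<in> ?J" if "a \<in> W" for a
    using bij_betw_apply[OF p, of a] that by (auto simp: W_def h_def k_def)
  have W: "finite W" by (simp add: W_def)
  obtain f :: "(nat, 'r) diagram" where f: "labelled_diagram W f"
      "map fst (source f) = As" "map fst (target f) = Bs"
    and a: "\<And>a. a \<in> W \<Longrightarrow> enable a (source f) = fst (h a)"
      "\<And>a. a \<in> W \<Longrightarrow> enable a (target f) = fst (k a)"
      "\<And>a. a \<in> W \<Longrightarrow> rank_one a f (U (unit_vector (h a)) (k a)) (snd (h a)) (snd (k a))"
    \<comment> \<open>The coefficient of a world is the entry of the matrix of \<open>U\<close> at
      its pair of basis elements.\<close>
    using ex_matrix_unit_diagram[OF W, of h As k Bs, OF hk,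
        where c = "\<lambda>a. U (unit_vector (h a)) (k a)"]
    by blast
  have "agnostic_semantics W f u = U u" if u: "u \<in> free_module ?I" for u
  proof
    fix j
    have "agnostic_semantics W f u j =
        (\<Sum>a\<in>W. if j = snd (p a)
           then U (unit_vector (fst (p a))) (snd (p a)) * u (fst (p a)) else 0)"
      using agnostic_semantics_rank_one[OF W f(2), where h = h and k = k, OF hk(1) a u]
      unfolding h_def k_def by simp
    also have "\<dots> = (\<Sum>q\<in>?I \<times> ?J. if j = snd q
           then U (unit_vector (fst q)) (snd q) * u (fst q) else 0)"
      by (rule sum.reindex_bij_betw[OF p[folded W_def]])
    also have "\<dots> = (\<Sum>i\<in>?I. \<Sum>j'\<in>?J. if j = j' then U (unit_vector i) j' * u i else 0)"
      by (simp add: sum.cartesian_product case_prod_beta)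
    also have "\<dots> = (\<Sum>i\<in>?I. if j \<in> ?J then U (unit_vector i) j * u i else 0)"
      by (simp add: finite_total_basis)
    also have "\<dots> = (\<Sum>i\<in>?I. U (unit_vector i) j * u i)"
    proof (rule sum.cong[OF refl])
      fix i assume "i \<in> ?I"
      then have "U (unit_vector i) \<in> free_module ?J"
        using assms unit_vector_in_free_module[of i ?I] unfolding linear_map_def by blast
      then show "(if j \<in> ?J then U (unit_vector i) j * u i else 0) = U (unit_vector i) j * u i"
        by (cases j) (simp add: free_module_def)
    qed
    also have "\<dots> = U u j"
      by (simp add: linear_map_expand[OF assms finite_total_basis u])
    finally show "agnostic_semantics W f u j = U u j" .
  qed
  with W f show ?thesis by blast
qed

end
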